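(* Let $A$ be a dissipative operator on a complex Hilbert space $\mathcal{H}$ and let $q_A$ be the quadratic form with domain $\mathcal{D}(q_A)=\mathcal{D}(A)$ given by $q_A(f)=\mathrm{Im}\langle f,Af\rangle$. Assume that $q_A$ is closable and that there exists an $\varepsilon>0$ such that $q_A(f)\geq\varepsilon\|f\|^2$ for all $f\in\mathcal{D}(A)$. Let $V_A$ be the selfadjoint operator associated to the closure of $q_A$, and let $W_A$ be the operator given by $$\mathcal{D}(W_A)=\mathrm{ran}\big(V_A^{1/2}\upharpoonright_{\mathcal{D}(A)}\big),\qquad W_A g= AV_A^{-1/2}g .$$ Let $B$ be a linear operator on $\mathcal{H}$ extending $A$, and let $\mathcal{V}$ be any subspace complementary to $\mathcal{D}(A)$ in $\mathcal{D}(B)$, i.e. $\mathcal{D}(A)\cap\mathcal{V}=\{0\}$ and $\mathcal{D}(B)=\mathcal{D}(A)\dot{+}\mathcal{V}$. Then $B$ is dissipative if and only if $\mathcal{V}\subset\mathcal{D}(W_A^* )$ and $$\mathrm{Im}\langle v,Bv\rangle\geq\frac{1}{4}\big\|(V_A^{-1/2}B-W_A^* )v\big\|^2\qquad\text{for every } v\in\mathcal{V}.$$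
   Context: Inner products are linear in the second component. A densely defined linear operator $A$ on $\mathcal{H}$ is called dissipative if $\mathrm{Im}\langle f,Af\rangle\geq 0$ for all $f\in\mathcal{D}(A)$. $\mathcal{D}(\cdot)$ and $\mathrm{ran}(\cdot)$ denote domain and range, $T\upharpoonright_{\mathcal{D}}$ denotes restriction to a subspace $\mathcal{D}$, and $\dot{+}$ denotes an algebraic direct sum. A (nonnegative) quadratic form $q$ is closable if for every sequence $\{f_n\}\subset\mathcal{D}(q)$ with $\|f_n\|\to0$ and $q(f_n-f_m)\to 0$ as $n,m\to\infty$ one has $q(f_n)\to0$. Its closure $q'$ then has domain consisting of all $f\in\mathcal{H}$ for which there is a sequence $\{f_n\}\subset\mathcal{D}(q)$ with $\|f_n-f\|\to0$ and $q(f_n-f_m)\to0$, and $q'(f):=\lim_n q(f_n)$. The selfadjoint operator $V_A\ge 0$ associated to $q_A'$ is the one given by the representation theorem for closed nonnegative forms: $\mathcal{D}(V_A^{1/2})=\mathcal{D}(q_A')$ and $\|V_A^{1/2}f\|^2=q_A'(f)$. Under the assumption $q_A\ge\varepsilon\|\cdot\|^2$, $V_A^{1/2}$ is boundedly invertible with inverse $V_A^{-1/2}$ defined on all of $\mathcal{H}$, and $W_A$ is densely defined, so $W_A^*$ exists. *)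

theory Defs
  imports "HOL-Analysis.Analysis"
begin

text \<open>
  A complex Hilbert space is presented over its underlying real Hilbert space: the real inner
  product is the real part of the complex one, so norm, topology and completeness are those of
  the library. The complex inner product is linear in its second argument.
\<close>

class complex_hilbert = real_inner + complete_space +
  fixes scaleC :: "complex \<Rightarrow> 'a \<Rightarrow> 'a" (infixr "*\<^sub>C" 75)
    and cinner :: "'a \<Rightarrow> 'a \<Rightarrow> complex"
  assumes scaleC_add_right: "c *\<^sub>C (x + y) = c *\<^sub>C x + c *\<^sub>C y"
    and scaleC_add_left: "(c + d) *\<^sub>C x = c *\<^sub>C x + d *\<^sub>C x"
    and scaleC_scaleC: "c *\<^sub>C d *\<^sub>C x = (c * d) *\<^sub>C x"
    and scaleR_scaleC: "r *\<^sub>R x = complex_of_real r *\<^sub>C x"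
    and cinner_add_right: "cinner x (y + z) = cinner x y + cinner x z"
    and cinner_scaleC_right: "cinner x (c *\<^sub>C y) = c * cinner x y"
    and cinner_commute: "cinner x y = cnj (cinner y x)"
    and inner_eq_Re_cinner: "inner x y = Re (cinner x y)"

lemma vector_space_scaleC: "vector_space (scaleC :: complex \<Rightarrow> 'a::complex_hilbert \<Rightarrow> 'a)"
proof
  show "1 *\<^sub>C x = x" for x :: 'a
    using scaleR_scaleC [of 1 x] by simp
qed (simp_all add: scaleC_add_right scaleC_add_left scaleC_scaleC)

abbreviation csubspace :: "'a::complex_hilbert set \<Rightarrow> bool"
  where "csubspace \<equiv> module.subspace scaleC"


text \<open>
  An unbounded operator is a domain together with a total function whose values outside the
  domain are irrelevant; hence operators are compared by \<open>op_eq\<close> rather than by \<open>=\<close>.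
\<close>

record 'a lop =
  op_dom :: "'a set"
  op_app :: "'a \<Rightarrow> 'a"

definition linear_op :: "'a::complex_hilbert lop \<Rightarrow> bool"
  where "linear_op T \<longleftrightarrow>
    csubspace (op_dom T) \<and>
    (\<forall>f\<in>op_dom T. \<forall>g\<in>op_dom T. op_app T (f + g) = op_app T f + op_app T g) \<and>
    (\<forall>c. \<forall>f\<in>op_dom T. op_app T (c *\<^sub>C f) = c *\<^sub>C op_app T f)"

definition densely_defined :: "'a::complex_hilbert lop \<Rightarrow> bool"
  where "densely_defined T \<longleftrightarrow> closure (op_dom T) = UNIV"

definition op_extends :: "'a lop \<Rightarrow> 'a lop \<Rightarrow> bool"
  where "op_extends B A \<longleftrightarrow>
    op_dom A \<subseteq> op_dom B \<and> (\<forall>f\<in>op_dom A. op_app B f = op_app A f)"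

definition op_eq :: "'a lop \<Rightarrow> 'a lop \<Rightarrow> bool"
  where "op_eq S T \<longleftrightarrow> op_dom S = op_dom T \<and> (\<forall>f\<in>op_dom S. op_app S f = op_app T f)"

definition op_comp :: "'a lop \<Rightarrow> 'a lop \<Rightarrow> 'a lop"
  where "op_comp S T =
    \<lparr>op_dom = {f \<in> op_dom T. op_app T f \<in> op_dom S}, op_app = (\<lambda>f. op_app S (op_app T f))\<rparr>"

text \<open>Meaningful for injective operators.\<close>

definition op_inverse :: "'a lop \<Rightarrow> 'a lop"
  where "op_inverse T =
    \<lparr>op_dom = op_app T ` op_dom T, op_app = inv_into (op_dom T) (op_app T)\<rparr>"

text \<open>Meaningful for densely defined operators, for which the vector \<open>h\<close> is unique.\<close>

definition adjoint_op :: "'a::complex_hilbert lop \<Rightarrow> 'a lop"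
  where "adjoint_op T =
    \<lparr>op_dom = {g. \<exists>h. \<forall>f\<in>op_dom T. cinner g (op_app T f) = cinner h f},
     op_app = (\<lambda>g. THE h. \<forall>f\<in>op_dom T. cinner g (op_app T f) = cinner h f)\<rparr>"

definition dissipative :: "'a::complex_hilbert lop \<Rightarrow> bool"
  where "dissipative A \<longleftrightarrow> linear_op A \<and> densely_defined A \<and>
    (\<forall>f\<in>op_dom A. Im (cinner f (op_app A f)) \<ge> 0)"

definition selfadjoint :: "'a::complex_hilbert lop \<Rightarrow> bool"
  where "selfadjoint T \<longleftrightarrow> linear_op T \<and> densely_defined T \<and> op_eq T (adjoint_op T)"

definition nonneg_op :: "'a::complex_hilbert lop \<Rightarrow> bool"
  where "nonneg_op T \<longleftrightarrow> (\<forall>f\<in>op_dom T. cinner f (op_app T f) \<in> \<real>\<^sub>\<ge>\<^sub>0)"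

definition is_op_sqrt :: "'a::complex_hilbert lop \<Rightarrow> 'a lop \<Rightarrow> bool"
  where "is_op_sqrt S V \<longleftrightarrow> selfadjoint S \<and> nonneg_op S \<and> op_eq (op_comp S S) V"


record 'a qform =
  form_dom :: "'a set"
  form_val :: "'a \<Rightarrow> real"

definition form_Cauchy :: "'a::complex_hilbert qform \<Rightarrow> (nat \<Rightarrow> 'a) \<Rightarrow> bool"
  where "form_Cauchy q F \<longleftrightarrow> (\<forall>n. F n \<in> form_dom q) \<and>
    ((\<lambda>(n, m). form_val q (F n - F m)) \<longlongrightarrow> 0) (sequentially \<times>\<^sub>F sequentially)"

definition closable_form :: "'a::complex_hilbert qform \<Rightarrow> bool"
  where "closable_form q \<longleftrightarrow>
    (\<forall>F. form_Cauchy q F \<longrightarrow> F \<longlonglongrightarrow> 0 \<longrightarrow> (\<lambda>n. form_val q (F n)) \<longlonglongrightarrow> 0)"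

text \<open>For a closable nonnegative form the limit does not depend on the approximating sequence.\<close>

definition form_closure :: "'a::complex_hilbert qform \<Rightarrow> 'a qform"
  where "form_closure q =
    \<lparr>form_dom = {f. \<exists>F. form_Cauchy q F \<and> F \<longlonglongrightarrow> f},
     form_val = (\<lambda>f. THE c. \<exists>F. form_Cauchy q F \<and> F \<longlonglongrightarrow> f \<and>
                               (\<lambda>n. form_val q (F n)) \<longlonglongrightarrow> c)\<rparr>"

text \<open>
  The operator \<open>V\<close> associated to a closed nonnegative form \<open>q\<close> by the representation theorem,
  together with its square root \<open>S\<close>.
\<close>

definition represents_form :: "'a::complex_hilbert qform \<Rightarrow> 'a lop \<Rightarrow> 'a lop \<Rightarrow> bool"
  where "represents_form q V S \<longleftrightarrow>
    selfadjoint V \<and> nonneg_op V \<and> is_op_sqrt S V \<and>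
    op_dom S = form_dom q \<and> (\<forall>f\<in>form_dom q. (norm (op_app S f))\<^sup>2 = form_val q f)"


definition im_form :: "'a::complex_hilbert lop \<Rightarrow> 'a qform"
  where "im_form A = \<lparr>form_dom = op_dom A, form_val = (\<lambda>f. Im (cinner f (op_app A f)))\<rparr>"

text \<open>Here \<open>S\<close> stands for the square root of the operator associated to \<open>form_closure (im_form A)\<close>.\<close>

definition W_op :: "'a lop \<Rightarrow> 'a lop \<Rightarrow> 'a lop"
  where "W_op A S =
    \<lparr>op_dom = op_app S ` op_dom A, op_app = (\<lambda>g. op_app A (op_app (op_inverse S) g))\<rparr>"

end

theory Submission
  imports Defs
begin

text \<open>
  Write \<open>S = V_A\<^sup>1\<^sup>/\<^sup>2\<close>. For \<open>f\<close> in the domain of \<open>A\<close> and \<open>v \<in> \<V>\<close>, the imaginary part of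
  \<open>\<langle>f + v, B (f + v)\<rangle>\<close> is \<open>\<parallel>S f\<parallel>\<^sup>2 + Im (L f) + Im \<langle>v, B v\<rangle>\<close>, where
  \<open>L f = \<langle>v, A f\<rangle> - \<langle>S\<^sup>-\<^sup>1 B v, S f\<rangle>\<close>. Replacing \<open>f\<close> by real multiples and taking the discriminant, this is
  nonnegative for all \<open>f\<close> iff \<open>\<bar>Im (L f)\<bar>\<^sup>2 \<le> 4 Im \<langle>v, B v\<rangle> \<parallel>S f\<parallel>\<^sup>2\<close> for all \<open>f\<close>. Since the vectors \<open>S f\<close> are dense,
  the Riesz theorem turns this into \<open>L f = \<langle>l, S f\<rangle>\<close> with \<open>\<parallel>l\<parallel>\<^sup>2 \<le> 4 Im \<langle>v, B v\<rangle>\<close>, which says that \<open>v\<close> lies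
  in the domain of \<open>W_A\<^sup>*\<close> and \<open>l = W_A\<^sup>* v - S\<^sup>-\<^sup>1 B v\<close>.
\<close>

section \<open>Nonnegative real quadratics and Riesz representation\<close>

lemma quadratic_nonneg_imp_discriminant:
  fixes a b c :: real
  assumes nonneg: "\<And>t. a * t\<^sup>2 + b * t + c \<ge> 0" and "a \<ge> 0"
  shows "b\<^sup>2 \<le> 4 * a * c"
proof (cases "a = 0")
  case True
  have "b = 0"
  proof (rule ccontr)
    assume "b \<noteq> 0"
    \<comment> \<open>At this point \<open>t\<close> the linear expression \<open>b * t + c\<close>
      takes the value -1.\<close>
    then show False
      using nonneg [of "- (c + 1) / b"] True by simp
  qed
  with True show ?thesis by simp
next
  case False
  with \<open>a \<ge> 0\<close> have "a > 0" by simp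
  \<comment> \<open>The test point is the vertex of the parabola.\<close>
  have "a * (- b / (2 * a))\<^sup>2 + b * (- b / (2 * a)) + c = c - b\<^sup>2 / (4 * a)"
    using \<open>a > 0\<close> by (simp add: field_simps power2_eq_square)
  with nonneg [of "- b / (2 * a)"] have "b\<^sup>2 / (4 * a) \<le> c" by simp
  with \<open>a > 0\<close> show ?thesis by (simp add: field_simps)
qed

text \<open>\<open>D\<close> is not assumed closed: the representing vector is a limit of points of
  \<open>D\<close> and may lie outside \<open>D\<close>. The functional is only real linear, which
  allows the imaginary part of a complex functional to be represented.\<close>

lemma Riesz_subspace:
  fixes D :: "'a::{real_inner, complete_space} set" and \<phi> :: "'a \<Rightarrow> real"
  assumes D: "subspace D"
    and add: "\<And>x y. x \<in> D \<Longrightarrow> y \<in> D \<Longrightarrow> \<phi> (x + y) = \<phi> x + \<phi> y"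
    and scale: "\<And>r x. x \<in> D \<Longrightarrow> \<phi> (r *\<^sub>R x) = r * \<phi> x"
    and bound: "\<And>x. x \<in> D \<Longrightarrow> \<bar>\<phi> x\<bar> \<le> M * norm x"
    and "M \<ge> 0"
  obtains k where "\<And>x. x \<in> D \<Longrightarrow> \<phi> x = inner k x" and "norm k \<le> M"
proof -
  \<comment> \<open>The representing vector minimises \<open>J\<close>; minimising sequences are Cauchy by the parallelogram law.\<close>
  define J where "J x = (norm x)\<^sup>2 - 2 * \<phi> x" for x
  define m where "m = Inf (J ` D)"
  have lower: "J x \<ge> - M\<^sup>2" if "x \<in> D" for x
  proof -
    have "(norm x - M)\<^sup>2 \<ge> 0" by simp
    then have "(norm x)\<^sup>2 - 2 * (M * norm x) + M\<^sup>2 \<ge> 0"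
      by (simp add: power2_diff algebra_simps)
    then show ?thesis using bound [OF that] unfolding J_def by linarith
  qed
  then have bdd: "bdd_below (J ` D)" by (meson bdd_belowI2)
  have m_le: "m \<le> J x" if "x \<in> D" for x
    unfolding m_def using bdd that by (simp add: cINF_lower)
  have "\<exists>x\<in>D. J x < m + inverse (real (Suc n))" for n
  proof -
    have "J ` D \<noteq> {}" using subspace_0 [OF D] by blast
    then have "\<exists>y\<in>J ` D. y < m + inverse (real (Suc n))"
      unfolding m_def using bdd by (subst cInf_less_iff [symmetric]) auto
    then show ?thesis by blast
  qed
  then obtain g where gD: "\<And>n. g n \<in> D" and gJ: "\<And>n. J (g n) < m + inverse (real (Suc n))"
    by metis
  have dist_bound: "(norm (g n - g p))\<^sup>2 \<le> 2 * inverse (real (Suc n)) + 2 * inverse (real (Suc p))" for n p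
  proof -
    have mid: "(1 / 2) *\<^sub>R (g n + g p) \<in> D" by (intro subspace_scale subspace_add D gD)
    have "J ((1 / 2) *\<^sub>R (g n + g p)) = (norm (g n + g p))\<^sup>2 / 4 - (\<phi> (g n) + \<phi> (g p))"
      unfolding J_def by (simp add: scale add gD subspace_add [OF D] power_mult_distrib power_divide)
        (simp add: field_simps)
    moreover have "(norm (g n + g p))\<^sup>2 + (norm (g n - g p))\<^sup>2 = 2 * (norm (g n))\<^sup>2 + 2 * (norm (g p))\<^sup>2"
      by (simp add: power2_norm_eq_inner inner_add inner_diff inner_commute)
    ultimately have "(norm (g n - g p))\<^sup>2 = 2 * J (g n) + 2 * J (g p) - 4 * J ((1 / 2) *\<^sub>R (g n + g p))"
      unfolding J_def by (simp add: field_simps)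
    then show ?thesis using m_le [OF mid] gJ [of n] gJ [of p] by linarith
  qed
  have "Cauchy g"
  proof (rule metric_CauchyI)
    fix e :: real assume "e > 0"
    then obtain N where N: "inverse (real (Suc N)) < e\<^sup>2 / 4"
      using reals_Archimedean [of "e\<^sup>2 / 4"] by auto
    have "dist (g n) (g p) < e" if "n \<ge> N" "p \<ge> N" for n p
    proof -
      have "inverse (real (Suc n)) \<le> inverse (real (Suc N))" "inverse (real (Suc p)) \<le> inverse (real (Suc N))"
        using that by (simp_all add: field_simps)
      with N dist_bound [of n p] have "(norm (g n - g p))\<^sup>2 < e\<^sup>2" by linarith
      then show ?thesis using \<open>e > 0\<close> by (simp add: dist_norm power2_less_imp_less)
    qed
    then show "\<exists>N. \<forall>n\<ge>N. \<forall>p\<ge>N. dist (g n) (g p) < e" by blast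
  qed
  then obtain k where k: "g \<longlonglongrightarrow> k" using Cauchy_convergent_iff convergent_def by blast
  have rep: "\<phi> x = inner k x" if x: "x \<in> D" for x
  proof -
    \<comment> \<open>First variation at the minimum: \<open>J (g n + t *\<^sub>R x)\<close> stays
      above \<open>m\<close> while \<open>J (g n)\<close> exceeds \<open>m\<close> by less than
      \<open>inverse (real (Suc n))\<close>, an error that vanishes in the limit.\<close>
    have "(norm x)\<^sup>2 * t\<^sup>2 + (2 * (inner k x - \<phi> x)) * t + 0 \<ge> 0" for t
    proof -
      have "(norm x)\<^sup>2 * t\<^sup>2 + (2 * (inner (g n) x - \<phi> x)) * t + inverse (real (Suc n)) \<ge> 0" for n
      proof -
        have "J (g n + t *\<^sub>R x) = J (g n) + ((norm x)\<^sup>2 * t\<^sup>2 + (2 * (inner (g n) x - \<phi> x)) * t)"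
          unfolding J_def
          by (simp add: add scale gD x subspace_scale [OF D] power2_norm_eq_inner inner_add
              inner_commute algebra_simps) (simp add: power2_eq_square)
        moreover have "m \<le> J (g n + t *\<^sub>R x)"
          by (intro m_le subspace_add subspace_scale D gD x)
        ultimately show ?thesis using gJ [of n] by linarith
      qed
      moreover have "(\<lambda>n. (norm x)\<^sup>2 * t\<^sup>2 + (2 * (inner (g n) x - \<phi> x)) * t + inverse (real (Suc n)))
          \<longlonglongrightarrow> (norm x)\<^sup>2 * t\<^sup>2 + (2 * (inner k x - \<phi> x)) * t + 0"
        by (intro tendsto_intros k LIMSEQ_inverse_real_of_nat)
      ultimately show ?thesis by (meson LIMSEQ_le_const)
    qed
    \<comment> \<open>With constant term 0 the discriminant bound forces the linear coefficient to
      vanish.\<close>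
    from quadratic_nonneg_imp_discriminant [OF this] show ?thesis by simp
  qed
  \<comment> \<open>As \<open>k\<close> need not lie in \<open>D\<close>, the bound is applied to
    \<open>g n\<close> and carried to the limit.\<close>
  have "inner k k \<le> M * norm k"
  proof (rule LIMSEQ_le)
    show "(\<lambda>n. inner k (g n)) \<longlonglongrightarrow> inner k k" "(\<lambda>n. M * norm (g n)) \<longlonglongrightarrow> M * norm k"
      by (intro tendsto_intros k)+
    show "\<exists>N. \<forall>n\<ge>N. inner k (g n) \<le> M * norm (g n)"
      using rep gD bound by (metis abs_le_D1)
  qed
  then have "norm k \<le> M"
    by (cases "k = 0") (simp_all add: \<open>M \<ge> 0\<close> power2_norm_eq_inner [symmetric] power2_eq_square)
  with rep show thesis by (rule that)
qed

section \<open>Calculus of the complex inner product\<close>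

lemma module_scaleC: "module (scaleC :: complex \<Rightarrow> 'a::complex_hilbert \<Rightarrow> 'a)"
  using vector_space_scaleC module_iff_vector_space by blast

lemmas csubspace_0 = module.subspace_0 [OF module_scaleC]
  and csubspace_add = module.subspace_add [OF module_scaleC]
  and csubspace_diff = module.subspace_diff [OF module_scaleC]
  and csubspace_scaleC = module.subspace_scale [OF module_scaleC]
  and scaleC_minus_left = module.scale_minus_left [OF module_scaleC]

lemma csubspace_imp_subspace: "csubspace D \<Longrightarrow> subspace D"
  by (simp add: subspace_def csubspace_0 csubspace_add csubspace_scaleC scaleR_scaleC)

lemma cinner_add_left: "cinner (x + y) z = cinner x z + cinner y z"
  by (metis cinner_add_right cinner_commute complex_cnj_add)

lemma cinner_scaleC_left: "cinner (c *\<^sub>C x) y = cnj c * cinner x y"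
  by (metis cinner_commute cinner_scaleC_right complex_cnj_mult)

lemma cinner_scaleR_right: "cinner x (r *\<^sub>R y) = of_real r * cinner x y"
  by (simp add: scaleR_scaleC cinner_scaleC_right)

lemma cinner_scaleR_left: "cinner (r *\<^sub>R x) y = of_real r * cinner x y"
  by (simp add: scaleR_scaleC cinner_scaleC_left)

lemma cinner_diff_left: "cinner (x - y) z = cinner x z - cinner y z"
  using cinner_add_left [of "x - y" y z] by simp

text \<open>Reduces imaginary parts to the real inner product, so that Cauchy-Schwarz and continuity
  carry over to them.\<close>

lemma Im_cinner_eq_inner: "Im (cinner x y) = - inner x (\<i> *\<^sub>C y)"
  by (simp add: inner_eq_Re_cinner cinner_scaleC_right)

lemma norm_scaleC_ii: "norm (\<i> *\<^sub>C x) = norm x"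
  by (simp add: norm_eq_sqrt_inner inner_eq_Re_cinner cinner_scaleC_right cinner_scaleC_left)

lemma abs_Im_cinner_le: "\<bar>Im (cinner x y)\<bar> \<le> norm x * norm y"
  using Cauchy_Schwarz_ineq2 [of x "\<i> *\<^sub>C y"] by (simp add: Im_cinner_eq_inner norm_scaleC_ii)

lemma cinner_self: "cinner x x = of_real ((norm x)\<^sup>2)"
proof -
  have "Im (cinner x x) = 0"
    by (metis cinner_commute cnj.simps(2) equal_neg_zero)
  then show ?thesis by (simp add: complex_eq_iff power2_norm_eq_inner inner_eq_Re_cinner)
qed

text \<open>A complex antilinear-linear identity follows from its imaginary part, by rotating \<open>y\<close>.\<close>

lemma tendsto_cinner_left:
  assumes "F \<longlonglongrightarrow> f"
  shows "(\<lambda>n. cinner (F n) x) \<longlonglongrightarrow> cinner f x"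
  by (rule tendsto_complex_iff [THEN iffD2])
    (auto simp: Im_cinner_eq_inner inner_eq_Re_cinner [symmetric] intro!: tendsto_intros assms)

lemma tendsto_cinner_right:
  assumes "F \<longlonglongrightarrow> f"
  shows "(\<lambda>n. cinner x (F n)) \<longlonglongrightarrow> cinner x f"
proof -
  have "(\<lambda>n. cnj (cinner (F n) x)) \<longlonglongrightarrow> cnj (cinner f x)"
    by (intro tendsto_intros tendsto_cinner_left assms)
  then show ?thesis by (simp flip: cinner_commute)
qed

text \<open>Approximating \<open>x - y\<close> itself from \<open>D\<close> makes it orthogonal to
  itself. This gives the uniqueness that adjoints need.\<close>

lemma eq_if_cinner_eq_on_dense:
  assumes dense: "closure D = UNIV" and eq: "\<And>f. f \<in> D \<Longrightarrow> cinner x f = cinner y f"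
  shows "x = y"
proof -
  obtain F where F: "\<And>n. F n \<in> D" "F \<longlonglongrightarrow> x - y"
    using dense closure_sequential by (metis UNIV_I)
  have "cinner (x - y) (F n) = 0" for n
    by (simp add: cinner_diff_left eq F)
  then have "(\<lambda>n. 0) \<longlonglongrightarrow> cinner (x - y) (x - y)"
    using tendsto_cinner_right [OF F(2), of "x - y"] by simp
  then have "cinner (x - y) (x - y) = 0"
    by (simp add: LIMSEQ_const_iff)
  then show ?thesis by (simp add: cinner_self)
qed

section \<open>Linear operators, adjoints and selfadjointness\<close>

lemma linear_op_csubspace: "linear_op T \<Longrightarrow> csubspace (op_dom T)"
  by (simp add: linear_op_def)

lemma linear_op_add:
  "linear_op T \<Longrightarrow> f \<in> op_dom T \<Longrightarrow> g \<in> op_dom T \<Longrightarrow> op_app T (f + g) = op_app T f + op_app T g"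
  by (simp add: linear_op_def)

lemma linear_op_scaleC:
  "linear_op T \<Longrightarrow> f \<in> op_dom T \<Longrightarrow> op_app T (c *\<^sub>C f) = c *\<^sub>C op_app T f"
  by (simp add: linear_op_def)

lemma linear_op_scaleR:
  "linear_op T \<Longrightarrow> f \<in> op_dom T \<Longrightarrow> op_app T (r *\<^sub>R f) = r *\<^sub>R op_app T f"
  by (simp add: linear_op_scaleC scaleR_scaleC)

lemma linear_op_diff:
  assumes "linear_op T" "f \<in> op_dom T" "g \<in> op_dom T"
  shows "op_app T (f - g) = op_app T f - op_app T g"
  using linear_op_add [OF assms(1), of "f - g" g] assms
  by (simp add: csubspace_diff linear_op_csubspace)

lemma linear_op_dom_scaleR: "linear_op T \<Longrightarrow> f \<in> op_dom T \<Longrightarrow> r *\<^sub>R f \<in> op_dom T"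
  by (simp add: scaleR_scaleC csubspace_scaleC linear_op_csubspace)

text \<open>Density of the domain makes the vector chosen by \<open>THE\<close> in
  \<open>adjoint_op\<close> unique, so any vector with the defining property is the value.\<close>

lemma adjoint_op_eqI:
  assumes "densely_defined T" "\<And>f. f \<in> op_dom T \<Longrightarrow> cinner g (op_app T f) = cinner h f"
  shows "g \<in> op_dom (adjoint_op T)" and "op_app (adjoint_op T) g = h"
proof -
  show "g \<in> op_dom (adjoint_op T)"
    using assms(2) by (auto simp: adjoint_op_def)
  show "op_app (adjoint_op T) g = h"
    unfolding adjoint_op_def lop.simps
  proof (rule the_equality)
    show "\<forall>f\<in>op_dom T. cinner g (op_app T f) = cinner h f" using assms(2) by blast
    show "h' = h" if "\<forall>f\<in>op_dom T. cinner g (op_app T f) = cinner h' f" for h'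
      using assms that by (intro eq_if_cinner_eq_on_dense [of "op_dom T"]) (auto simp: densely_defined_def)
  qed
qed

lemma adjoint_op_cinner:
  assumes "densely_defined T" "g \<in> op_dom (adjoint_op T)" "f \<in> op_dom T"
  shows "cinner g (op_app T f) = cinner (op_app (adjoint_op T) g) f"
proof -
  obtain h where h: "\<And>f. f \<in> op_dom T \<Longrightarrow> cinner g (op_app T f) = cinner h f"
    using assms(2) by (auto simp: adjoint_op_def)
  then show ?thesis using adjoint_op_eqI(2) [OF assms(1) h] assms(3) by simp
qed

lemma selfadjoint_cinner:
  assumes "selfadjoint S" "f \<in> op_dom S" "g \<in> op_dom S"
  shows "cinner f (op_app S g) = cinner (op_app S f) g"
  using assms adjoint_op_cinner [of S f g] by (simp add: selfadjoint_def op_eq_def)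

text \<open>A weak identity suffices for membership in the domain, because \<open>S\<close> and its
  adjoint have the same domain. Surjectivity and closedness both rest on this.\<close>

lemma selfadjoint_eqI:
  assumes "selfadjoint S" "\<And>f. f \<in> op_dom S \<Longrightarrow> cinner g (op_app S f) = cinner h f"
  shows "g \<in> op_dom S" and "op_app S g = h"
  using assms adjoint_op_eqI [of S g h] by (auto simp: selfadjoint_def op_eq_def)

lemma bounded_below_inj_on:
  assumes lin: "linear_op S" and "d > 0"
    and below: "\<And>f. f \<in> op_dom S \<Longrightarrow> d * norm f \<le> norm (op_app S f)"
  shows "inj_on (op_app S) (op_dom S)"
proof (rule inj_onI)
  fix f g assume "f \<in> op_dom S" "g \<in> op_dom S" "op_app S f = op_app S g"
  then show "f = g"
    using below [of "f - g"] \<open>d > 0\<close>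
    by (simp add: linear_op_diff [OF lin] csubspace_diff [OF linear_op_csubspace [OF lin]] mult_le_0_iff)
qed

text \<open>On the range of \<open>S\<close> the functional sending \<open>x\<close> to the inner
  product of \<open>y\<close> with the preimage of \<open>x\<close> is bounded by
  \<open>norm y / d\<close>. A Riesz vector \<open>k\<close> for it satisfies \<langle>k, S
  f\<rangle> = \<langle>y, f\<rangle> on the domain, and selfadjointness turns this into
  \<open>S k = y\<close>.\<close>

lemma selfadjoint_surj:
  assumes S: "selfadjoint S" and "d > 0"
    and below: "\<And>f. f \<in> op_dom S \<Longrightarrow> d * norm f \<le> norm (op_app S f)"
  obtains k where "k \<in> op_dom S" "op_app S k = y"
proof -
  have lin: "linear_op S" using S by (simp add: selfadjoint_def)
  note sub = linear_op_csubspace [OF lin]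
  define R where "R = op_app S ` op_dom S"
  define T where "T = inv_into (op_dom S) (op_app S)"
  have T: "T (op_app S f) = f" if "f \<in> op_dom S" for f
    using that bounded_below_inj_on [OF lin \<open>d > 0\<close> below] by (simp add: T_def)
  have R: "subspace R"
  proof (rule subspaceI)
    show "0 \<in> R"
      using linear_op_diff [OF lin, of 0 0] csubspace_0 [OF sub] by (force simp: R_def)
    show "x + y \<in> R" if "x \<in> R" "y \<in> R" for x y
      using that csubspace_add [OF sub] by (force simp: R_def linear_op_add [OF lin, symmetric])
    show "r *\<^sub>R x \<in> R" if "x \<in> R" for r x
      using that linear_op_dom_scaleR [OF lin] by (force simp: R_def linear_op_scaleR [OF lin, symmetric])
  qed
  obtain k where k: "\<And>x. x \<in> R \<Longrightarrow> inner y (T x) = inner k x"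
  proof (rule Riesz_subspace [OF R])
    show "inner y (T (x + x')) = inner y (T x) + inner y (T x')" if "x \<in> R" "x' \<in> R" for x x'
      using that csubspace_add [OF sub]
      by (auto simp: R_def T inner_add linear_op_add [OF lin, symmetric])
    show "inner y (T (r *\<^sub>R x)) = r * inner y (T x)" if "x \<in> R" for r x
      using that linear_op_dom_scaleR [OF lin] by (auto simp: R_def T linear_op_scaleR [OF lin, symmetric])
    show "\<bar>inner y (T x)\<bar> \<le> norm y / d * norm x" if "x \<in> R" for x
    proof -
      have "norm (T x) \<le> norm x / d"
        using that below \<open>d > 0\<close> by (auto simp: R_def T field_simps)
      then have "norm y * norm (T x) \<le> norm y * (norm x / d)"
        by (intro mult_left_mono) auto
      then show ?thesis using Cauchy_Schwarz_ineq2 [of y "T x"] by simp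
    qed
  qed (use \<open>d > 0\<close> in auto)
  have Re_eq: "Re (cinner k (op_app S f)) = Re (cinner y f)" if "f \<in> op_dom S" for f
    using k [of "op_app S f"] that by (simp add: R_def T inner_eq_Re_cinner)
  \<comment> \<open>The real identity at \<i> \<open>f\<close> supplies the imaginary part at
    \<open>f\<close>.\<close>
  have "cinner k (op_app S f) = cinner y f" if f: "f \<in> op_dom S" for f
  proof (rule complex_eqI)
    show "Im (cinner k (op_app S f)) = Im (cinner y f)"
      using Re_eq [OF csubspace_scaleC [OF sub f], of \<i>]
      by (simp add: linear_op_scaleC [OF lin f] cinner_scaleC_right)
  qed (rule Re_eq [OF f])
  then show thesis using selfadjoint_eqI [OF S, of k y] that by blast
qed

section \<open>The form \<open>im_form A\<close> and its closure\<close>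

lemma dissipative_linear: "dissipative A \<Longrightarrow> linear_op A"
  and dissipative_dense: "dissipative A \<Longrightarrow> densely_defined A"
  and dissipative_Im_nonneg: "dissipative A \<Longrightarrow> f \<in> op_dom A \<Longrightarrow> 0 \<le> Im (cinner f (op_app A f))"
  by (auto simp: dissipative_def)

lemma form_dom_im_form [simp]: "form_dom (im_form A) = op_dom A"
  and form_val_im_form: "form_val (im_form A) f = Im (cinner f (op_app A f))"
  by (simp_all add: im_form_def)

lemma im_form_scaleR:
  assumes "linear_op A" "f \<in> op_dom A"
  shows "form_val (im_form A) (r *\<^sub>R f) = r\<^sup>2 * form_val (im_form A) f"
  using assms by (simp add: form_val_im_form linear_op_scaleR cinner_scaleR_left cinner_scaleR_right
      power2_eq_square)

lemma im_form_add:
  assumes "linear_op A" "f \<in> op_dom A" "g \<in> op_dom A"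
  shows "form_val (im_form A) (f + g) = form_val (im_form A) f + form_val (im_form A) g
    + (Im (cinner f (op_app A g)) + Im (cinner g (op_app A f)))"
  using assms by (simp add: form_val_im_form linear_op_add cinner_add_left cinner_add_right)

text \<open>Nonnegativity of the form along the line \<open>f + t *\<^sub>R g\<close> yields,
  through the discriminant, a Cauchy-Schwarz bound on the cross term \<beta>. Hence the square root
  of the form is a seminorm.\<close>

lemma sqrt_im_form_triangle:
  assumes A: "dissipative A" and f: "f \<in> op_dom A" and g: "g \<in> op_dom A"
  shows "sqrt (form_val (im_form A) (f + g)) \<le> sqrt (form_val (im_form A) f) + sqrt (form_val (im_form A) g)"
proof -
  let ?q = "form_val (im_form A)"
  note lin = dissipative_linear [OF A]
  have q_nonneg: "?q h \<ge> 0" if "h \<in> op_dom A" for h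
    using dissipative_Im_nonneg [OF A that] by (simp add: form_val_im_form)
  define \<beta> where "\<beta> = Im (cinner f (op_app A g)) + Im (cinner g (op_app A f))"
  have "?q g * t\<^sup>2 + \<beta> * t + ?q f \<ge> 0" for t
  proof -
    have tg: "t *\<^sub>R g \<in> op_dom A" using lin g by (rule linear_op_dom_scaleR)
    have "?q (f + t *\<^sub>R g) = ?q g * t\<^sup>2 + \<beta> * t + ?q f"
      by (simp add: im_form_add [OF lin f tg] im_form_scaleR [OF lin g] \<beta>_def
          linear_op_scaleR [OF lin g] cinner_scaleR_left cinner_scaleR_right algebra_simps)
    then show ?thesis
      using q_nonneg [OF csubspace_add [OF linear_op_csubspace [OF lin] f tg]] by simp
  qed
  from quadratic_nonneg_imp_discriminant [OF this q_nonneg [OF g]]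
  have "\<beta>\<^sup>2 \<le> (2 * sqrt (?q f) * sqrt (?q g))\<^sup>2"
    using q_nonneg [OF f] q_nonneg [OF g] by (simp only: power_mult_distrib real_sqrt_pow2) (simp add: mult.commute mult.left_commute)
  then have "\<beta> \<le> 2 * sqrt (?q f) * sqrt (?q g)"
    by (rule power2_le_imp_le) (simp add: q_nonneg f g)
  moreover have "(sqrt (?q f) + sqrt (?q g))\<^sup>2 = ?q f + ?q g + 2 * sqrt (?q f) * sqrt (?q g)"
    using q_nonneg [OF f] q_nonneg [OF g] by (simp only: power2_sum real_sqrt_pow2)
  ultimately have "?q (f + g) \<le> (sqrt (?q f) + sqrt (?q g))\<^sup>2"
    using im_form_add [OF lin f g] unfolding \<beta>_def by linarith
  then show ?thesis
    using q_nonneg [OF f] q_nonneg [OF g] by (intro real_le_lsqrt) simp_all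
qed

lemma im_form_minus_commute:
  assumes "linear_op A" "f \<in> op_dom A" "g \<in> op_dom A"
  shows "form_val (im_form A) (f - g) = form_val (im_form A) (g - f)"
  using im_form_scaleR [of A "g - f" "- 1"] assms
  by (simp add: csubspace_diff linear_op_csubspace)

lemma sqrt_im_form_diff:
  assumes A: "dissipative A" and f: "f \<in> op_dom A" and g: "g \<in> op_dom A"
  shows "\<bar>sqrt (form_val (im_form A) f) - sqrt (form_val (im_form A) g)\<bar>
    \<le> sqrt (form_val (im_form A) (f - g))"
  using sqrt_im_form_triangle [OF A _ g, of "f - g"] sqrt_im_form_triangle [OF A _ f, of "g - f"]
    f g im_form_minus_commute [OF dissipative_linear [OF A] f g]
  by (simp add: csubspace_diff linear_op_csubspace dissipative_linear [OF A])

text \<open>Restates the product-filter limit through the seminorm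
  \<open>sqrt (form_val (im_form A) f)\<close>, to which the triangle inequality applies.\<close>

lemma form_Cauchy_im_form_iff:
  assumes A: "dissipative A"
  shows "form_Cauchy (im_form A) F \<longleftrightarrow> (\<forall>n. F n \<in> op_dom A) \<and>
    (\<forall>e>0. \<exists>N. \<forall>n\<ge>N. \<forall>m\<ge>N. sqrt (form_val (im_form A) (F n - F m)) < e)"
proof -
  let ?q = "form_val (im_form A)"
  have "((\<lambda>(n, m). ?q (F n - F m)) \<longlongrightarrow> 0) (sequentially \<times>\<^sub>F sequentially) \<longleftrightarrow>
      (\<forall>e>0. \<exists>N. \<forall>n\<ge>N. \<forall>m\<ge>N. sqrt (?q (F n - F m)) < e)" (is "?L \<longleftrightarrow> ?R")
    if F: "\<And>n. F n \<in> op_dom A"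
  proof -
    have nonneg: "?q (F n - F m) \<ge> 0" for n m
      using F A by (simp add: form_val_im_form dissipative_Im_nonneg csubspace_diff
          linear_op_csubspace dissipative_linear)
    have "?L \<longleftrightarrow> (\<forall>e>0. \<exists>N. \<forall>n\<ge>N. \<forall>m\<ge>N. ?q (F n - F m) < e)"
      by (simp add: tendsto_iff eventually_prod_sequentially nonneg) meson
    also have "\<dots> \<longleftrightarrow> ?R"
    proof safe
      fix e :: real assume "e > 0" "\<forall>e>0. \<exists>N. \<forall>n\<ge>N. \<forall>m\<ge>N. ?q (F n - F m) < e"
      then have "\<exists>N. \<forall>n\<ge>N. \<forall>m\<ge>N. ?q (F n - F m) < e\<^sup>2" by simp
      then show "\<exists>N. \<forall>n\<ge>N. \<forall>m\<ge>N. sqrt (?q (F n - F m)) < e"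
        using \<open>e > 0\<close> by (meson real_less_lsqrt less_imp_le)
    next
      fix e :: real assume "e > 0" "\<forall>e>0. \<exists>N. \<forall>n\<ge>N. \<forall>m\<ge>N. sqrt (?q (F n - F m)) < e"
      then have "\<exists>N. \<forall>n\<ge>N. \<forall>m\<ge>N. sqrt (?q (F n - F m)) < sqrt e"
        using real_sqrt_gt_zero by blast
      then show "\<exists>N. \<forall>n\<ge>N. \<forall>m\<ge>N. ?q (F n - F m) < e" by simp
    qed
    finally show ?thesis .
  qed
  then show ?thesis by (auto simp: form_Cauchy_def)
qed

lemma form_Cauchy_im_formE:
  assumes "dissipative A" "form_Cauchy (im_form A) F" "e > 0"
  obtains N where "\<forall>n\<ge>N. \<forall>m\<ge>N. sqrt (form_val (im_form A) (F n - F m)) < e"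
  using assms form_Cauchy_im_form_iff [of A F] by blast

lemma form_Cauchy_diff:
  assumes A: "dissipative A" and F: "form_Cauchy (im_form A) F" and G: "form_Cauchy (im_form A) G"
  shows "form_Cauchy (im_form A) (\<lambda>n. F n - G n)"
  unfolding form_Cauchy_im_form_iff [OF A]
proof (intro conjI allI impI)
  let ?p = "\<lambda>f. sqrt (form_val (im_form A) f)"
  have dom: "F n \<in> op_dom A" "G n \<in> op_dom A" for n
    using F G by (auto simp: form_Cauchy_def)
  note lin = dissipative_linear [OF A]
  note sub = linear_op_csubspace [OF lin]
  show "F n - G n \<in> op_dom A" for n
    by (intro csubspace_diff sub dom)
  fix e :: real assume "e > 0"
  then have "e / 2 > 0" by simp
  obtain M where M: "\<forall>n\<ge>M. \<forall>m\<ge>M. ?p (F n - F m) < e / 2"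
    using form_Cauchy_im_formE [OF A F \<open>e / 2 > 0\<close>] .
  obtain N where N: "\<forall>n\<ge>N. \<forall>m\<ge>N. ?p (G n - G m) < e / 2"
    using form_Cauchy_im_formE [OF A G \<open>e / 2 > 0\<close>] .
  have "?p ((F n - G n) - (F m - G m)) < e" if "n \<ge> max M N" "m \<ge> max M N" for n m
  proof -
    \<comment> \<open>The indices of \<open>G\<close> are exchanged so that the difference of
      differences becomes a sum.\<close>
    have "?p ((F n - F m) + (G m - G n)) \<le> ?p (F n - F m) + ?p (G m - G n)"
      by (intro sqrt_im_form_triangle A csubspace_diff sub dom)
    also have "\<dots> < e" using M [rule_format, of n m] N [rule_format, of m n] that by simp
    finally show ?thesis by (simp add: algebra_simps)
  qed
  then show "\<exists>N. \<forall>n\<ge>N. \<forall>m\<ge>N. ?p ((F n - G n) - (F m - G m)) < e" by blast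
qed

text \<open>This justifies the \<open>THE\<close> in \<open>form_closure\<close>. Limits exist
  because the seminorms of a form-Cauchy sequence are Cauchy in the reals; they agree for two
  sequences because closability applies to the difference, which tends to 0.\<close>

lemma form_closure_limit:
  assumes A: "dissipative A" and closable: "closable_form (im_form A)"
    and F: "form_Cauchy (im_form A) F" and lim: "F \<longlonglongrightarrow> f"
  shows "(\<lambda>n. form_val (im_form A) (F n)) \<longlonglongrightarrow> form_val (form_closure (im_form A)) f"
proof -
  let ?q = "form_val (im_form A)"
  have dom: "G n \<in> op_dom A" if "form_Cauchy (im_form A) G" for G n
    using that by (simp add: form_Cauchy_def)
  have square: "(sqrt (?q h))\<^sup>2 = ?q h" if "h \<in> op_dom A" for h
    using dissipative_Im_nonneg [OF A that] by (simp add: form_val_im_form)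
  have "Cauchy (\<lambda>n. sqrt (?q (F n)))"
  proof (rule metric_CauchyI)
    fix e :: real assume "e > 0"
    from form_Cauchy_im_formE [OF A F this] obtain N
      where N: "\<forall>n\<ge>N. \<forall>m\<ge>N. sqrt (?q (F n - F m)) < e" .
    have "dist (sqrt (?q (F n))) (sqrt (?q (F m))) < e" if "n \<ge> N" "m \<ge> N" for n m
      using sqrt_im_form_diff [OF A dom [OF F] dom [OF F], of n m] N [rule_format, OF that]
      by (simp add: dist_real_def)
    then show "\<exists>N. \<forall>n\<ge>N. \<forall>m\<ge>N. dist (sqrt (?q (F n))) (sqrt (?q (F m))) < e" by blast
  qed
  then obtain c where c: "(\<lambda>n. sqrt (?q (F n))) \<longlonglongrightarrow> c"
    using Cauchy_convergent_iff convergent_def by blast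
  then have c2: "(\<lambda>n. ?q (F n)) \<longlonglongrightarrow> c\<^sup>2"
    using tendsto_power [OF c, of 2] by (simp add: square dom [OF F])
  have unique: "d = c\<^sup>2" if G: "form_Cauchy (im_form A) G" "G \<longlonglongrightarrow> f" "(\<lambda>n. ?q (G n)) \<longlonglongrightarrow> d" for G d
  proof -
    have "(\<lambda>n. F n - G n) \<longlonglongrightarrow> 0"
      using tendsto_diff [OF lim G(2)] by simp
    with closable form_Cauchy_diff [OF A F G(1)] have "(\<lambda>n. ?q (F n - G n)) \<longlonglongrightarrow> 0"
      by (simp add: closable_form_def)
    from tendsto_real_sqrt [OF this] have "(\<lambda>n. sqrt (?q (F n - G n))) \<longlonglongrightarrow> 0" by simp
    then have "(\<lambda>n. sqrt (?q (F n)) - sqrt (?q (G n))) \<longlonglongrightarrow> 0"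
      by (rule Lim_null_comparison [rotated])
        (simp add: sqrt_im_form_diff [OF A dom [OF F] dom [OF G(1)]])
    then have "c - sqrt d = 0"
      using tendsto_diff [OF c tendsto_real_sqrt [OF G(3)]] LIMSEQ_unique by blast
    \<comment> \<open>As \<open>sqrt\<close> also takes values on negative reals,
      \<open>c = sqrt d\<close> gives \<open>d = c\<^sup>2\<close> only once \<open>d\<close> is
      known to be nonnegative.\<close>
    moreover have "d \<ge> 0"
      using G(3) dissipative_Im_nonneg [OF A dom [OF G(1)]]
      by (intro LIMSEQ_le_const) (auto simp: form_val_im_form)
    ultimately show ?thesis by simp
  qed
  have "form_val (form_closure (im_form A)) f = c\<^sup>2"
    unfolding form_closure_def qform.simps
  proof (rule the_equality)
    show "\<exists>F. form_Cauchy (im_form A) F \<and> F \<longlonglongrightarrow> f \<and> (\<lambda>n. ?q (F n)) \<longlonglongrightarrow> c\<^sup>2"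
      using F lim c2 by (intro exI conjI)
    show "d = c\<^sup>2"
      if "\<exists>F. form_Cauchy (im_form A) F \<and> F \<longlonglongrightarrow> f \<and> (\<lambda>n. ?q (F n)) \<longlonglongrightarrow> d" for d
      using that by (elim exE conjE) (rule unique)
  qed
  with c2 show ?thesis by simp
qed

section \<open>Closedness and the square root of the represented operator\<close>

text \<open>The symmetry relation against a fixed \<open>h\<close> in the domain passes to the
  limit, and the weak characterisation of \<open>S\<close> does the rest.\<close>

lemma selfadjoint_closed:
  assumes S: "selfadjoint S" and F: "\<And>n. F n \<in> op_dom S" "F \<longlonglongrightarrow> f"
    and lim: "(\<lambda>n. op_app S (F n)) \<longlonglongrightarrow> y"
  shows "f \<in> op_dom S" and "op_app S f = y"
proof -
  have "cinner f (op_app S h) = cinner y h" if h: "h \<in> op_dom S" for h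
  proof (rule LIMSEQ_unique)
    show "(\<lambda>n. cinner (F n) (op_app S h)) \<longlonglongrightarrow> cinner f (op_app S h)"
      by (rule tendsto_cinner_left [OF F(2)])
    show "(\<lambda>n. cinner (F n) (op_app S h)) \<longlonglongrightarrow> cinner y h"
      using tendsto_cinner_left [OF lim] by (simp add: selfadjoint_cinner [OF S F(1) h])
  qed
  from selfadjoint_eqI [OF S this] show "f \<in> op_dom S" "op_app S f = y" by blast+
qed

lemma represents_form_selfadjoint: "represents_form q V S \<Longrightarrow> selfadjoint S"
  by (simp add: represents_form_def is_op_sqrt_def)

lemma norm_sqrt_op_limit:
  assumes A: "dissipative A" and closable: "closable_form (im_form A)"
    and S: "represents_form (form_closure (im_form A)) V S"
    and F: "form_Cauchy (im_form A) F" "F \<longlonglongrightarrow> f"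
  shows "f \<in> op_dom S" and "(\<lambda>n. form_val (im_form A) (F n)) \<longlonglongrightarrow> (norm (op_app S f))\<^sup>2"
proof -
  have f: "f \<in> form_dom (form_closure (im_form A))"
    using F by (auto simp: form_closure_def)
  with S show "f \<in> op_dom S" by (simp add: represents_form_def)
  show "(\<lambda>n. form_val (im_form A) (F n)) \<longlonglongrightarrow> (norm (op_app S f))\<^sup>2"
    using form_closure_limit [OF A closable F] S f by (simp add: represents_form_def)
qed

text \<open>The constant sequence at \<open>f\<close> is form-Cauchy, so the closure agrees with the
  original form on the domain of \<open>A\<close>.\<close>

lemma norm_sqrt_op:
  assumes A: "dissipative A" and closable: "closable_form (im_form A)"
    and S: "represents_form (form_closure (im_form A)) V S" and f: "f \<in> op_dom A"
  shows "f \<in> op_dom S" and "(norm (op_app S f))\<^sup>2 = form_val (im_form A) f"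
proof -
  have "form_val (im_form A) 0 = 0"
    using im_form_scaleR [OF dissipative_linear [OF A] f, of 0] by simp
  then have F: "form_Cauchy (im_form A) (\<lambda>_. f)"
    using f by (simp add: form_Cauchy_im_form_iff [OF A])
  show "f \<in> op_dom S" by (rule norm_sqrt_op_limit [OF A closable S F]) simp
  show "(norm (op_app S f))\<^sup>2 = form_val (im_form A) f"
    using norm_sqrt_op_limit(2) [OF A closable S F tendsto_const] by (simp add: LIMSEQ_const_iff)
qed

text \<open>The domain of \<open>A\<close> is a core for \<open>S\<close>: along a form-Cauchy
  sequence the images under \<open>S\<close> are Cauchy, since the norm of
  \<open>S (F n - F m)\<close> is the seminorm of \<open>F n - F m\<close>, and closedness of
  \<open>S\<close> identifies their limit.\<close>

lemma sqrt_op_core: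
  assumes A: "dissipative A" and closable: "closable_form (im_form A)"
    and S: "represents_form (form_closure (im_form A)) V S" and f: "f \<in> op_dom S"
  obtains F where "\<And>n. F n \<in> op_dom A" "F \<longlonglongrightarrow> f" "(\<lambda>n. op_app S (F n)) \<longlonglongrightarrow> op_app S f"
proof -
  note Sself = represents_form_selfadjoint [OF S]
  have Slin: "linear_op S" using Sself by (simp add: selfadjoint_def)
  have "f \<in> form_dom (form_closure (im_form A))"
    using S f by (simp add: represents_form_def)
  then obtain F where F: "form_Cauchy (im_form A) F" and lim: "F \<longlonglongrightarrow> f"
    by (auto simp: form_closure_def)
  have FA: "F n \<in> op_dom A" for n using F by (simp add: form_Cauchy_def)
  have FS: "F n \<in> op_dom S" for n by (rule norm_sqrt_op [OF A closable S FA])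
  have norm_diff: "norm (op_app S (F n) - op_app S (F m)) = sqrt (form_val (im_form A) (F n - F m))" for n m
  proof -
    have "F n - F m \<in> op_dom A"
      by (intro csubspace_diff linear_op_csubspace dissipative_linear A FA)
    from norm_sqrt_op(2) [OF A closable S this, symmetric] show ?thesis
      by (simp add: linear_op_diff [OF Slin FS FS])
  qed
  have "Cauchy (\<lambda>n. op_app S (F n))"
  proof (rule metric_CauchyI)
    fix e :: real assume "e > 0"
    from form_Cauchy_im_formE [OF A F this] obtain N
      where "\<forall>n\<ge>N. \<forall>m\<ge>N. sqrt (form_val (im_form A) (F n - F m)) < e" .
    then show "\<exists>N. \<forall>n\<ge>N. \<forall>m\<ge>N. dist (op_app S (F n)) (op_app S (F m)) < e"
      unfolding dist_norm norm_diff by (rule exI)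
  qed
  then obtain y where y: "(\<lambda>n. op_app S (F n)) \<longlonglongrightarrow> y"
    using Cauchy_convergent_iff convergent_def by blast
  with selfadjoint_closed(2) [OF Sself FS lim y] show thesis
    using that FA lim by blast
qed

text \<open>The lower bound of the form is a bound between squared norms, hence the constant
  \<open>sqrt \<epsilon>\<close>; it extends from the domain of \<open>A\<close> along the
  core.\<close>

lemma norm_sqrt_op_ge:
  assumes A: "dissipative A" and closable: "closable_form (im_form A)"
    and S: "represents_form (form_closure (im_form A)) V S"
    and below: "\<And>f. f \<in> op_dom A \<Longrightarrow> form_val (im_form A) f \<ge> \<epsilon> * (norm f)\<^sup>2" and "\<epsilon> > 0"
    and f: "f \<in> op_dom S"
  shows "sqrt \<epsilon> * norm f \<le> norm (op_app S f)"
proof -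
  obtain F where F: "\<And>n. F n \<in> op_dom A" "F \<longlonglongrightarrow> f" "(\<lambda>n. op_app S (F n)) \<longlonglongrightarrow> op_app S f"
    using sqrt_op_core [OF A closable S f] by blast
  have "sqrt \<epsilon> * norm (F n) \<le> norm (op_app S (F n))" for n
  proof (rule power2_le_imp_le)
    show "(sqrt \<epsilon> * norm (F n))\<^sup>2 \<le> (norm (op_app S (F n)))\<^sup>2"
      using below [OF F(1)] \<open>\<epsilon> > 0\<close>
      by (simp add: norm_sqrt_op(2) [OF A closable S F(1)] power_mult_distrib)
  qed simp
  then show ?thesis
    by (intro LIMSEQ_le [OF tendsto_mult_left [OF tendsto_norm [OF F(2)]] tendsto_norm [OF F(3)]]) auto
qed

text \<open>Since \<open>S\<close> is injective and onto, \<open>op_inverse S\<close> is a genuine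
  inverse and \<open>y\<close> ranges over the whole space.\<close>

lemma op_inverse_sqrt_op:
  assumes S: "selfadjoint S" and "d > 0"
    and below: "\<And>f. f \<in> op_dom S \<Longrightarrow> d * norm f \<le> norm (op_app S f)"
  shows "op_app (op_inverse S) y \<in> op_dom S" and "op_app S (op_app (op_inverse S) y) = y"
    and "f \<in> op_dom S \<Longrightarrow> op_app (op_inverse S) (op_app S f) = f"
proof -
  have lin: "linear_op S" using S by (simp add: selfadjoint_def)
  have "y \<in> op_app S ` op_dom S"
    using selfadjoint_surj [OF S \<open>d > 0\<close> below] by (metis imageI)
  then show "op_app (op_inverse S) y \<in> op_dom S" "op_app S (op_app (op_inverse S) y) = y"
    by (simp_all add: op_inverse_def inv_into_into f_inv_into_f)
  show "op_app (op_inverse S) (op_app S f) = f" if "f \<in> op_dom S"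
    using that bounded_below_inj_on [OF lin \<open>d > 0\<close> below] by (simp add: op_inverse_def)
qed

section \<open>The dissipativity criterion for extensions\<close>

theorem theorem3p1:
  fixes A B V_A S_A :: "'a::complex_hilbert lop"
    and \<V> :: "'a set"
  assumes "dissipative A"
    and "closable_form (im_form A)"
    and "\<exists>\<epsilon>>0. \<forall>f\<in>op_dom A. form_val (im_form A) f \<ge> \<epsilon> * (norm f)\<^sup>2"
    and "represents_form (form_closure (im_form A)) V_A S_A"
    and "linear_op B"
    and "op_extends B A"
    and "csubspace \<V>"
    and "op_dom A \<inter> \<V> = {0}"
    and "op_dom B = {f + v |f v. f \<in> op_dom A \<and> v \<in> \<V>}"
  shows "dissipative B \<longleftrightarrow>
    \<V> \<subseteq> op_dom (adjoint_op (W_op A S_A)) \<and>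
    (\<forall>v\<in>\<V>. Im (cinner v (op_app B v)) \<ge>
       1 / 4 * (norm (op_app (op_inverse S_A) (op_app B v) - op_app (adjoint_op (W_op A S_A)) v))\<^sup>2)"
proof -
  note A = assms(1) and Aclosable = assms(2) and rep = assms(4) and B = assms(5) and domB = assms(9)
  define S where "S = op_app S_A"
  define R where "R = op_app (op_inverse S_A)"
  define W where "W = W_op A S_A"
  note Alin = dissipative_linear [OF A]
  note Asub = linear_op_csubspace [OF Alin]
  note Sself = represents_form_selfadjoint [OF rep]
  have Slin: "linear_op S_A" using Sself by (simp add: selfadjoint_def)
  obtain \<epsilon> where "\<epsilon> > 0" and eps: "\<And>f. f \<in> op_dom A \<Longrightarrow> form_val (im_form A) f \<ge> \<epsilon> * (norm f)\<^sup>2"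
    using assms(3) by blast
  have below: "sqrt \<epsilon> * norm f \<le> norm (op_app S_A f)" if "f \<in> op_dom S_A" for f
    using norm_sqrt_op_ge [OF A Aclosable rep eps \<open>\<epsilon> > 0\<close> that] .
  have "sqrt \<epsilon> > 0" using \<open>\<epsilon> > 0\<close> by simp
  note inverse = op_inverse_sqrt_op [OF Sself \<open>sqrt \<epsilon> > 0\<close> below, folded S_def R_def]
  have dom_AS: "f \<in> op_dom S_A" and norm_S: "(norm (S f))\<^sup>2 = Im (cinner f (op_app A f))"
    if "f \<in> op_dom A" for f
    using norm_sqrt_op [OF A Aclosable rep that] by (simp_all add: S_def form_val_im_form)
  have domW: "op_dom W = S ` op_dom A" by (simp add: W_def W_op_def S_def)
  have W_S: "op_app W (S f) = op_app A f" if "f \<in> op_dom A" for f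
    by (simp add: W_def W_op_def R_def [symmetric] inverse dom_AS that)
  \<comment> \<open>Write \<open>y = S (R y)\<close> and move \<open>S\<close> to the other side by
    symmetry.\<close>
  have SR: "cinner f y = cinner (S f) (R y)" if "f \<in> op_dom S_A" for f y
    using selfadjoint_cinner [OF Sself that inverse(1)] by (simp add: inverse(2) S_def [symmetric])
  have Wsub: "csubspace (op_dom W)"
  proof (rule module.subspaceI [OF module_scaleC])
    show "0 \<in> op_dom W"
      using csubspace_0 [OF Asub] linear_op_diff [OF Slin, of 0 0] dom_AS
      by (force simp: domW S_def)
    show "x + y \<in> op_dom W" if "x \<in> op_dom W" "y \<in> op_dom W" for x y
      using that csubspace_add [OF Asub] dom_AS by (force simp: domW S_def linear_op_add [OF Slin, symmetric])
    show "c *\<^sub>C x \<in> op_dom W" if "x \<in> op_dom W" for c x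
      using that csubspace_scaleC [OF Asub] dom_AS
      by (force simp: domW S_def linear_op_scaleC [OF Slin, symmetric])
  qed
  \<comment> \<open>The core property at \<open>R y\<close> approximates \<open>y = S (R y)\<close>
    by vectors \<open>S (F n)\<close> with \<open>F n\<close> in the domain of
    \<open>A\<close>.\<close>
  have Wdense: "densely_defined W"
    unfolding densely_defined_def
  proof (intro equalityI subset_UNIV subsetI)
    fix y
    obtain F where F: "\<And>n. F n \<in> op_dom A" "(\<lambda>n. S (F n)) \<longlonglongrightarrow> S (R y)"
      using sqrt_op_core [OF A Aclosable rep inverse(1) [of y]] unfolding S_def by blast
    then show "y \<in> closure (op_dom W)"
      unfolding closure_sequential domW by (auto simp: inverse(2) intro!: exI [of _ "\<lambda>n. S (F n)"])
  qed
  have BA: "op_app B f = op_app A f" if "f \<in> op_dom A" for f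
    using assms(6) that by (simp add: op_extends_def)
  have domBA: "f \<in> op_dom B" if "f \<in> op_dom A" for f
    using assms(6) that by (auto simp: op_extends_def)
  have domBV: "v \<in> op_dom B" if "v \<in> \<V>" for v
    using csubspace_0 [OF Asub] that unfolding domB by force
  define L where "L v f = cinner v (op_app A f) - cinner (R (op_app B v)) (S f)" for v f
  have expand: "Im (cinner (f + v) (op_app B (f + v)))
      = (norm (S f))\<^sup>2 + Im (L v f) + Im (cinner v (op_app B v))"
    if f: "f \<in> op_dom A" and v: "v \<in> \<V>" for f v
  proof -
    \<comment> \<open>Exchanging the arguments conjugates the inner product; this is the origin of
      the minus sign in \<open>L\<close>.\<close>
    have "Im (cinner f (op_app B v)) = - Im (cinner (R (op_app B v)) (S f))"
      by (subst SR [OF dom_AS [OF f]], subst cinner_commute) simp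
    then show ?thesis
      by (simp add: linear_op_add [OF B domBA [OF f] domBV [OF v]] BA [OF f] norm_S [OF f]
          cinner_add_left cinner_add_right L_def)
  qed
  have L_scaleC: "L v (c *\<^sub>C f) = c * L v f" if "f \<in> op_dom A" for v c f
    using that dom_AS [OF that]
    by (simp add: L_def S_def linear_op_scaleC [OF Alin] linear_op_scaleC [OF Slin] cinner_scaleC_right
        right_diff_distrib)
  have L_add: "L v (f + g) = L v f + L v g" if "f \<in> op_dom A" "g \<in> op_dom A" for v f g
    using that dom_AS
    by (simp add: L_def S_def linear_op_add [OF Alin] linear_op_add [OF Slin] cinner_add_right)
  have R_S: "R (S f) = f" if "f \<in> op_dom A" for f
    using inverse(3) dom_AS that by blast
  have S_scaleR: "S (r *\<^sub>R f) = r *\<^sub>R S f" if "f \<in> op_dom A" for r f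
    unfolding S_def using linear_op_scaleR [OF Slin] dom_AS that by blast
  show ?thesis
    unfolding W_def [symmetric] R_def [symmetric]
  proof (intro iffI conjI ballI subsetI)
    \<comment> \<open>One vector \<open>l\<close> yields both the domain membership and the norm
      bound, so the two are proved together.\<close>
    have *: "v \<in> op_dom (adjoint_op W) \<and>
        Im (cinner v (op_app B v)) \<ge> 1 / 4 * (norm (R (op_app B v) - op_app (adjoint_op W) v))\<^sup>2"
      if Bdiss: "dissipative B" and v: "v \<in> \<V>" for v
    proof -
      define c where "c = Im (cinner v (op_app B v))"
      have c: "c \<ge> 0"
        using dissipative_Im_nonneg [OF Bdiss domBV [OF v]] by (simp add: c_def)
      have bound: "\<bar>Im (L v f)\<bar> \<le> 2 * sqrt c * norm (S f)" if f: "f \<in> op_dom A" for f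
      proof -
        \<comment> \<open>Dissipativity of \<open>B\<close> is tested on
          \<open>t *\<^sub>R f + v\<close> with real \<open>t\<close>.\<close>
        have "(norm (S f))\<^sup>2 * t\<^sup>2 + Im (L v f) * t + c \<ge> 0" for t
        proof -
          have tf: "t *\<^sub>R f \<in> op_dom A" by (rule linear_op_dom_scaleR [OF Alin f])
          have "t *\<^sub>R f + v \<in> op_dom B" unfolding domB using tf v by blast
          from dissipative_Im_nonneg [OF Bdiss this]
          show ?thesis
            unfolding expand [OF tf v] S_scaleR [OF f]
            by (simp add: scaleR_scaleC [of t f] L_scaleC [OF f] c_def [symmetric]
                power_mult_distrib mult.commute)
        qed
        from quadratic_nonneg_imp_discriminant [OF this]
        have "(Im (L v f))\<^sup>2 \<le> (2 * sqrt c * norm (S f))\<^sup>2"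
          using c by (simp add: power_mult_distrib mult_ac)
        with c show ?thesis by (simp add: abs_le_square_iff [symmetric] abs_mult)
      qed
      \<comment> \<open>The functional is transported along \<open>R\<close> to the range of
        \<open>S\<close> on the domain of \<open>A\<close>, where the bound is in terms of the norm
        of the argument itself.\<close>
      obtain k where k: "\<And>x. x \<in> op_dom W \<Longrightarrow> Im (L v (R x)) = inner k x"
        and norm_k: "norm k \<le> 2 * sqrt c"
      proof (rule Riesz_subspace [OF csubspace_imp_subspace [OF Wsub]])
        show "Im (L v (R (x + y))) = Im (L v (R x)) + Im (L v (R y))"
          if xy: "x \<in> op_dom W" "y \<in> op_dom W" for x y
        proof -
          obtain f g where fg: "f \<in> op_dom A" "g \<in> op_dom A" "x = S f" "y = S g"
            using xy domW by blast
          then have "x + y = S (f + g)"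
            by (simp add: S_def linear_op_add [OF Slin] dom_AS)
          with fg show ?thesis by (simp add: R_S L_add csubspace_add [OF Asub])
        qed
        show "Im (L v (R (r *\<^sub>R x))) = r * Im (L v (R x))" if x: "x \<in> op_dom W" for r x
        proof -
          obtain f where f: "f \<in> op_dom A" "x = S f" using x domW by blast
          then show ?thesis
            by (simp add: S_scaleR [symmetric] R_S linear_op_dom_scaleR [OF Alin])
              (simp add: scaleR_scaleC L_scaleC)
        qed
        show "\<bar>Im (L v (R x))\<bar> \<le> 2 * sqrt c * norm x" if "x \<in> op_dom W" for x
          using that bound by (auto simp: domW R_S)
      qed (use c in auto)
      \<comment> \<open>\<open>k\<close> represents \<open>Im L\<close> as a real part; rotating it by \<open>-\<i>\<close> represents \<open>L\<close> itself.\<close>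
      define l where "l = (- \<i>) *\<^sub>C k"
      have Im_eq: "Im (L v f) = Im (cinner l (S f))" if f: "f \<in> op_dom A" for f
        using k [of "S f"] f by (simp add: domW R_S l_def inner_eq_Re_cinner cinner_scaleC_left)
      have L_eq: "L v f = cinner l (S f)" if f: "f \<in> op_dom A" for f
      proof (rule complex_eqI)
        have "S (\<i> *\<^sub>C f) = \<i> *\<^sub>C S f"
          unfolding S_def by (rule linear_op_scaleC [OF Slin dom_AS [OF f]])
        then show "Re (L v f) = Re (cinner l (S f))"
          using Im_eq [OF csubspace_scaleC [OF Asub f], of \<i>] by (simp add: L_scaleC [OF f] cinner_scaleC_right)
      qed (rule Im_eq [OF f])
      \<comment> \<open>Solving \<langle>l, S f\<rangle> = \<open>L v f\<close> for \<langle>v, A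
        f\<rangle> gives the defining relation of the adjoint of \<open>W\<close> at
        \<open>x = S f\<close>.\<close>
      have "cinner v (op_app W x) = cinner (R (op_app B v) + l) x" if "x \<in> op_dom W" for x
        using that L_eq unfolding L_def by (auto simp: domW W_S cinner_add_left algebra_simps)
      from adjoint_op_eqI [OF Wdense this]
      have adj: "v \<in> op_dom (adjoint_op W)" "op_app (adjoint_op W) v = R (op_app B v) + l" by blast+
      have "norm l = norm k"
        by (simp add: l_def scaleC_minus_left norm_scaleC_ii)
      then have "(norm l)\<^sup>2 \<le> (2 * sqrt c)\<^sup>2"
        using power_mono [OF norm_k norm_ge_zero, of 2] by simp
      with c adj show ?thesis by (simp add: c_def power_mult_distrib)
    qed
    show "v \<in> op_dom (adjoint_op W)" if "dissipative B" "v \<in> \<V>" for v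
      using * that by blast
    show "Im (cinner v (op_app B v)) \<ge> 1 / 4 * (norm (R (op_app B v) - op_app (adjoint_op W) v))\<^sup>2"
      if "dissipative B" "v \<in> \<V>" for v
      using * that by blast
  next
    assume *: "\<V> \<subseteq> op_dom (adjoint_op W) \<and> (\<forall>v\<in>\<V>. Im (cinner v (op_app B v)) \<ge>
      1 / 4 * (norm (R (op_app B v) - op_app (adjoint_op W) v))\<^sup>2)"
    have "Im (cinner (f + v) (op_app B (f + v))) \<ge> 0" if f: "f \<in> op_dom A" and v: "v \<in> \<V>" for f v
    proof -
      define k where "k = op_app (adjoint_op W) v - R (op_app B v)"
      have "cinner v (op_app W (S f)) = cinner (op_app (adjoint_op W) v) (S f)"
        by (rule adjoint_op_cinner [OF Wdense]) (use * v f domW in auto)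
      then have "L v f = cinner k (S f)"
        by (simp add: L_def k_def W_S [OF f] cinner_diff_left)
      then have "- (norm k * norm (S f)) \<le> Im (L v f)"
        using abs_Im_cinner_le [of k "S f"] by simp
      moreover have "1 / 4 * (norm k)\<^sup>2 \<le> Im (cinner v (op_app B v))"
        using * v by (simp add: k_def norm_minus_commute)
      \<comment> \<open>The factor 1/4 in the criterion is exactly what completes this
        square.\<close>
      moreover have "(norm (S f) - norm k / 2)\<^sup>2 = (norm (S f))\<^sup>2 - norm k * norm (S f) + 1 / 4 * (norm k)\<^sup>2"
        by (simp add: power2_diff power_divide)
      moreover have "(norm (S f) - norm k / 2)\<^sup>2 \<ge> 0" by simp
      ultimately show ?thesis unfolding expand [OF f v] by linarith
    qed
    moreover have "densely_defined B"
      using dissipative_dense [OF A] closure_mono [of "op_dom A" "op_dom B"] domBA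
      by (auto simp: densely_defined_def)
    ultimately show "dissipative B"
      unfolding dissipative_def using B by (auto simp: domB)
  qed
qed

end
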